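(* Let $p_a,p_b,p_c$ be nonnegative numbers summing to $1$, let $d\in\mathbb N$ and $q\in[0,1]$, and let $(G_t)_{t\ge0}$ be the growing directed graph generated by the hybrid (PageRank-based) selection model with these parameters (defined in the context). If $q<1$, then asymptotically almost surely (as $n\to\infty$) the diameter of $G_n$ is at most $18\log n/(1-q)$.
   Context: Conventions: $\mathbb N=\{1,2,\dots\}$; $\log$ is the natural logarithm. Graphs are finite and may have loops and parallel edges. Distance between two vertices of a directed graph is the number of edges in a shortest path ignoring edge directions; the diameter is the maximum distance between two vertices. The initial graph $G_0$ is finite of size $O(1)$ (bounded independently of $n$). "Asymptotically almost surely" means with probability tending to $1$ as $n\to\infty$. All random choices at time $t$ have the stated distributions conditionally on the history of the process up to time $t-1$. PageRank: for a directed graph $G$ and $q\in[0,1]$, $\pi_q:V(G)\to[0,1]$ is the unique probability distribution satisfying $$\pi_q(v)=\frac{1-q}{|V(G)|}+q\sum_{u\in V(G)}\frac{\pi_q(u)\cdot\#(uv)}{\operatorname{out-deg}(u)},$$ where $\#(uv)$ is the number of copies of the directed edge $uv$ in $G$ and $\operatorname{out-deg}(u)$ is the out-degree of $u$. Hybrid selection model: every vertex has out-degree $d$. $G_0$ is a weakly connected directed graph with all vertices having out-degree $d$. In each time-step $t\in\mathbb N$, a new vertex is born and $d$ outgoing edges from it to vertices of $G_{t-1}$ are added. The heads of the new edges are chosen independently; for choosing the head of each edge, one of the following operations is performed, independently of previous choices: (a) with probability $p_a$, the head is a vertex sampled uniformly from $G_{t-1}$; (b) with probability $p_b$, it is the head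 of an edge sampled uniformly from $G_{t-1}$; (c) with probability $p_c$, it is a vertex of $G_{t-1}$ sampled according to the PageRank distribution $\pi_q$ of $G_{t-1}$. *)

theory Defs
  imports "HOL-Probability.Probability" "Graph_Theory.Graph_Theory"
begin

text \<open>A pmf with values in the possibly larger vertex type is a distribution on the vertex set
  if its support lies in that set.\<close>

definition is_pagerank :: "real \<Rightarrow> ('v, 'e) pre_digraph \<Rightarrow> 'v pmf \<Rightarrow> bool" where
  "is_pagerank q G \<pi> \<longleftrightarrow>
     set_pmf \<pi> \<subseteq> verts G \<and>
     (\<forall>v\<in>verts G. pmf \<pi> v =
        (1 - q) / real (card (verts G)) +
        q * (\<Sum>u\<in>verts G.
               pmf \<pi> u * real (card (out_arcs G u \<inter> in_arcs G v)) / real (out_degree G u)))"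

definition pagerank :: "real \<Rightarrow> ('v, 'e) pre_digraph \<Rightarrow> 'v pmf" where
  "pagerank q G = (THE \<pi>. is_pagerank q G \<pi>)"

text \<open>Drawing an arc uniformly and taking its head counts parallel arcs with multiplicity.\<close>

definition hybrid_head ::
    "real \<Rightarrow> real \<Rightarrow> real \<Rightarrow> real \<Rightarrow> ('v, 'e) pre_digraph \<Rightarrow> 'v pmf" where
  "hybrid_head pa pb pc q G =
     join_pmf (pmf_of_list
       [(pmf_of_set (verts G), pa),
        (map_pmf (head G) (pmf_of_set (arcs G)), pb),
        (pagerank q G, pc)])"

text \<open>Vertices and arcs of the initial graph are tagged with \<^const>\<open>Inl\<close>. The vertex born at time
  \<open>t\<close> is \<open>Inr t\<close>, and its \<open>i\<close>-th outgoing arc (\<open>i < d\<close>) is \<open>Inr (t, i)\<close>; in particular its tail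
  is fixed in advance. The heads of such arcs are set when they are added.\<close>

definition initial_graph ::
    "('v, 'e) pre_digraph \<Rightarrow> ('v + nat, 'e + nat \<times> nat) pre_digraph" where
  "initial_graph G =
     \<lparr> verts = Inl ` verts G,
       arcs = Inl ` arcs G,
       tail = case_sum (\<lambda>e. Inl (tail G e)) (\<lambda>(t, i). Inr t),
       head = case_sum (\<lambda>e. Inl (head G e)) (\<lambda>_. undefined) \<rparr>"

definition add_born_vertex ::
    "nat \<Rightarrow> ('v + nat) list \<Rightarrow> ('v + nat, 'e + nat \<times> nat) pre_digraph \<Rightarrow>
     ('v + nat, 'e + nat \<times> nat) pre_digraph" where
  "add_born_vertex t hs G =
     G\<lparr> verts := insert (Inr t) (verts G),
        arcs := arcs G \<union> {Inr (t, i) | i. i < length hs},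
        head := (\<lambda>e. if \<exists>i<length hs. e = Inr (t, i) then hs ! snd (projr e) else head G e) \<rparr>"

text \<open>\<open>hybrid_graph pa pb pc q d G0 n\<close> is the law of \<open>G\<^sub>n\<close>. Given the past, the choices at each
  step depend on the current graph only, so these laws are obtained by iterating the one-step
  kernel.\<close>

primrec hybrid_graph ::
    "real \<Rightarrow> real \<Rightarrow> real \<Rightarrow> real \<Rightarrow> nat \<Rightarrow> ('v, 'e) pre_digraph \<Rightarrow> nat \<Rightarrow>
     ('v + nat, 'e + nat \<times> nat) pre_digraph pmf" where
  "hybrid_graph pa pb pc q d G0 0 = return_pmf (initial_graph G0)"
| "hybrid_graph pa pb pc q d G0 (Suc t) =
     do { G \<leftarrow> hybrid_graph pa pb pc q d G0 t;
          hs \<leftarrow> replicate_pmf d (hybrid_head pa pb pc q G);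
          return_pmf (add_born_vertex (Suc t) hs G) }"

text \<open>Merging parallel arcs in \<^const>\<open>mk_symmetric\<close> does not affect distances. The distance is
  \<open>\<infinity>\<close> between different weak components.\<close>

definition undirected_dist :: "('v, 'e) pre_digraph \<Rightarrow> 'v \<Rightarrow> 'v \<Rightarrow> ereal" where
  "undirected_dist G u v = wf_digraph.\<mu> (with_proj (mk_symmetric G)) (\<lambda>_. 1) u v"

definition undirected_diameter :: "('v, 'e) pre_digraph \<Rightarrow> ereal" where
  "undirected_diameter G = (SUP u\<in>verts G. SUP v\<in>verts G. undirected_dist G u v)"

end

theory Submission
  imports Defs "HOL-Real_Asymp.Real_Asymp"
begin

text \<open>PageRank is the law of a random walk of geometric length started at a uniform vertex. Hence, if
  \<open>f\<close> grows by a factor of at most \<open>z < 1 / q\<close> along each arc, its PageRank mean is at most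
  \<open>(1 - q) / (1 - q z)\<close> times its uniform mean. This is applied to \<open>f(v) = z ^ depth(v)\<close>, with \<open>depth\<close>
  the undirected distance to a fixed initial vertex. The potential \<open>\<Sum>\<^sub>v z ^ depth(v)\<close> then grows
  in step \<open>t\<close> by an expected factor of at most \<open>1 + 3 / t\<close>, so its mean at time \<open>n\<close> is \<open>O(n\<^sup>3)\<close>. A
  diameter above \<open>18 ln n / (1 - q)\<close> forces a vertex of depth above \<open>9 ln n / (1 - q)\<close>; for
  \<open>z = 1 + (1 - q) / 2 \<ge> exp (7 (1 - q) / 20)\<close> the potential then exceeds \<open>n\<close> to the power
  \<open>63 / 20 > 3\<close>, which Markov's inequality rules out.\<close>

section \<open>Undirected distance to a root\<close>

text \<open>The symmetrised graph is the one in which \<open>undirected_dist\<close> measures walks;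
  taking it as a bare relation makes relation powers available.\<close>

definition adjacency :: "('v, 'e) pre_digraph \<Rightarrow> ('v \<times> 'v) set" where
  "adjacency G = parcs (mk_symmetric G)"

text \<open>For a vertex reachable from \<open>r\<close> this is the undirected distance. Otherwise
  \<open>LEAST\<close> ranges over an empty set and the value carries no meaning, which is why
  reachability accompanies \<open>depth\<close> as a hypothesis.\<close>

definition depth :: "('v, 'e) pre_digraph \<Rightarrow> 'v \<Rightarrow> 'v \<Rightarrow> nat" where
  "depth G r v = (LEAST k. (r, v) \<in> adjacency G ^^ k)"

lemma adjacency_alt:
  "adjacency G = (\<Union>e\<in>arcs G. {(tail G e, head G e), (head G e, tail G e)})"
  by (simp add: adjacency_def parcs_mk_symmetric)

lemma sym_adjacency: "sym (adjacency G)"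
  by (auto simp: adjacency_alt sym_def)

lemma depth_relpow:
  assumes "(r, v) \<in> (adjacency G)\<^sup>*"
  shows "(r, v) \<in> adjacency G ^^ depth G r v"
  using assms unfolding depth_def rtrancl_power by (metis (lifting) LeastI_ex)

lemma depth_le:
  assumes "(r, v) \<in> adjacency G ^^ k"
  shows "depth G r v \<le> k"
  using assms unfolding depth_def by (rule Least_le)

lemma depth_adjacent:
  assumes "(r, u) \<in> (adjacency G)\<^sup>*" and "(u, v) \<in> adjacency G"
  shows "depth G r v \<le> Suc (depth G r u)"
  using depth_relpow[OF assms(1)] assms(2) by (intro depth_le) auto

text \<open>New arcs can only shorten walks from the root. This keeps the contribution of the old
  vertices to the potential from rising when a vertex is born.\<close>

lemma depth_mono:
  assumes "adjacency G \<subseteq> adjacency H" and "(r, v) \<in> (adjacency G)\<^sup>*"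
  shows "depth H r v \<le> depth G r v"
proof (intro depth_le)
  have "(x, y) \<in> adjacency H ^^ n" if "(x, y) \<in> adjacency G ^^ n" for x y n
    using that assms(1) by (induction n arbitrary: y) auto
  then show "(r, v) \<in> adjacency H ^^ depth G r v"
    using depth_relpow[OF assms(2)] .
qed

section \<open>From relation powers to distances and the diameter\<close>

lemma relpow_sym:
  assumes "sym R" and "(a, b) \<in> R ^^ n"
  shows "(b, a) \<in> R ^^ n"
  using assms(2)
proof (induction n arbitrary: b)
  case (Suc n)
  then obtain c where "(a, c) \<in> R ^^ n" "(c, b) \<in> R"
    by (auto elim: relpow_Suc_E)
  then show ?case
    using Suc.IH assms(1) by (auto intro: relpow_Suc_I2 dest: symD simp del: relpow.simps)
qed simp

lemma (in wf_digraph) relpow_imp_awalk: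
  assumes "(u, v) \<in> arcs_ends G ^^ k" and "u \<in> verts G"
  shows "\<exists>p. awalk u p v \<and> length p = k"
  using assms
proof (induction k arbitrary: u)
  case 0
  then show ?case by (auto simp: awalk_Nil_iff)
next
  case (Suc k)
  then obtain w where w: "(u, w) \<in> arcs_ends G" "(w, v) \<in> arcs_ends G ^^ k"
    by (auto elim: relpow_Suc_E2 simp del: relpow.simps)
  then obtain e where e: "e \<in> arcs G" "tail G e = u" "head G e = w"
    by auto
  then obtain p where "awalk w p v" "length p = k"
    using Suc.IH[OF w(2)] by auto
  then show ?case
    using e by (intro exI[of _ "e # p"]) (auto simp: awalk_Cons_iff)
qed

lemma undirected_dist_le:
  assumes "wf_digraph G" and "u \<in> verts G" and "(u, v) \<in> adjacency G ^^ k"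
  shows "undirected_dist G u v \<le> ereal (real k)"
proof -
  interpret H: pair_wf_digraph "mk_symmetric G"
    using assms(1) by (rule wf_digraph.wellformed_mk_symmetric)
  obtain p where p: "H.awalk u p v" "length p = k"
    using H.relpow_imp_awalk[of u v k] assms by (auto simp: adjacency_def)
  have "H.awalk_cost (\<lambda>_. 1) p = real k"
    using p(2) by (simp add: H.awalk_cost_def sum_list_triv)
  then show ?thesis
    using H.min_cost_le_walk_cost[OF p(1), of "\<lambda>_. 1"] by (simp add: undirected_dist_def)
qed

text \<open>Any two vertices are joined by a walk through the root \<open>r\<close>. The factor 2
  turns the constant 18 of the diameter into 9 for the depth.\<close>

lemma undirected_diameter_le:
  assumes "wf_digraph G"
    and "\<And>v. v \<in> verts G \<Longrightarrow> (r, v) \<in> (adjacency G)\<^sup>*"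
    and "\<And>v. v \<in> verts G \<Longrightarrow> real (depth G r v) \<le> h"
  shows "undirected_diameter G \<le> ereal (2 * h)"
  unfolding undirected_diameter_def
proof (intro SUP_least)
  fix u v assume uv: "u \<in> verts G" "v \<in> verts G"
  have "(u, v) \<in> adjacency G ^^ (depth G r u + depth G r v)"
    unfolding relpow_add
    using relpow_sym[OF sym_adjacency depth_relpow[OF assms(2)[OF uv(1)]]]
      depth_relpow[OF assms(2)[OF uv(2)]] by auto
  from undirected_dist_le[OF assms(1) uv(1) this]
  have "undirected_dist G u v \<le> ereal (real (depth G r u + depth G r v))" .
  also have "\<dots> \<le> ereal (2 * h)"
    using assms(3)[OF uv(1)] assms(3)[OF uv(2)] by simp
  finally show "undirected_dist G u v \<le> ereal (2 * h)" .
qed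

lemma (in fin_digraph) adjacency_bounds:
  "finite (adjacency G)" "card (adjacency G) \<le> card (verts G) ^ 2"
proof -
  have sub: "adjacency G \<subseteq> verts G \<times> verts G"
    by (auto simp: adjacency_alt)
  then show "finite (adjacency G)"
    by (rule finite_subset) auto
  have "card (adjacency G) \<le> card (verts G \<times> verts G)"
    by (intro card_mono sub) auto
  then show "card (adjacency G) \<le> card (verts G) ^ 2"
    by (simp add: card_cartesian_product power2_eq_square)
qed

text \<open>Reachability in a finite relation takes at most as many steps as the relation has pairs.
  The crude square suffices, since the bound is applied to initial graphs of bounded size.\<close>

lemma (in fin_digraph) depth_le_card:
  assumes "(r, v) \<in> (adjacency G)\<^sup>*"
  shows "depth G r v \<le> card (verts G) ^ 2"
proof -
  obtain k where "k \<le> card (adjacency G)" "(r, v) \<in> adjacency G ^^ k"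
    using assms rtrancl_finite_eq_relpow[OF adjacency_bounds(1)] by auto
  then show ?thesis
    using depth_le adjacency_bounds(2) by fastforce
qed

section \<open>PageRank\<close>

text \<open>The list may repeat a value, whose weights then add up. This matters for
  \<open>hybrid_head\<close>, where the uniform, the arc-head and the PageRank law may coincide as
  elements of the list.\<close>

lemma expectation_pmf_of_list:
  fixes f :: "'a \<Rightarrow> real"
  assumes "pmf_of_list_wf xs"
  shows "measure_pmf.expectation (pmf_of_list xs) f = (\<Sum>(x, p)\<leftarrow>xs. p * f x)"
proof -
  \<comment> \<open>The index set \<open>A\<close> stays fixed while the list shrinks, so the
    induction need not follow how the set of entries changes.\<close>
  have *: "(\<Sum>x\<in>A. sum_list (map snd (filter (\<lambda>z. fst z = x) ys)) * f x) = (\<Sum>(x, p)\<leftarrow>ys. p * f x)"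
    if "finite A" "fst ` set ys \<subseteq> A" for A and ys :: "('a \<times> real) list"
    using that
  proof (induction ys)
    case (Cons y ys)
    have "(\<Sum>x\<in>A. sum_list (map snd (filter (\<lambda>z. fst z = x) (y # ys))) * f x) =
          (\<Sum>x\<in>A. (if fst y = x then snd y * f x else 0) +
             sum_list (map snd (filter (\<lambda>z. fst z = x) ys)) * f x)"
      by (intro sum.cong) (auto simp: algebra_simps)
    also have "\<dots> = snd y * f (fst y) + (\<Sum>(x, p)\<leftarrow>ys. p * f x)"
      using Cons by (simp add: sum.distrib)
    finally show ?case by (cases y) simp
  qed simp
  have "measure_pmf.expectation (pmf_of_list xs) f =
        (\<Sum>x\<in>set (map fst xs). pmf (pmf_of_list xs) x * f x)"
    using set_pmf_of_list[OF assms] by (subst integral_measure_pmf[of "set (map fst xs)"]) auto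
  also have "\<dots> = (\<Sum>(x, p)\<leftarrow>xs. p * f x)"
    unfolding pmf_pmf_of_list[OF assms] by (rule *) auto
  finally show ?thesis .
qed

locale nonsink_digraph = fin_digraph +
  assumes verts_nonempty: "verts G \<noteq> {}"
    and out_degree_pos: "v \<in> verts G \<Longrightarrow> out_degree G v > 0"
begin

definition surf :: "'a \<Rightarrow> 'a pmf" where
  "surf u = map_pmf (head G) (pmf_of_set (out_arcs G u))"

lemma out_arcs_nonempty: "u \<in> verts G \<Longrightarrow> out_arcs G u \<noteq> {}"
  using out_degree_pos[of u] by (auto simp: out_degree_def)

lemma finite_out: "finite (out_arcs G u)"
  by (rule finite_subset[of _ "arcs G"]) auto

lemma set_surf: "u \<in> verts G \<Longrightarrow> set_pmf (surf u) \<subseteq> verts G"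
  using out_arcs_nonempty[of u] by (auto simp: surf_def finite_out)

lemma pmf_surf:
  assumes "u \<in> verts G"
  shows "pmf (surf u) v = real (card (out_arcs G u \<inter> in_arcs G v)) / real (out_degree G u)"
proof -
  have "out_arcs G u \<inter> head G -` {v} = out_arcs G u \<inter> in_arcs G v"
    by auto
  then show ?thesis
    using out_arcs_nonempty[OF assms] finite_out[of u]
    by (simp add: surf_def pmf_map measure_pmf_of_set out_degree_def)
qed

lemma is_pagerank_surf:
  "is_pagerank q G \<pi> \<longleftrightarrow> set_pmf \<pi> \<subseteq> verts G \<and>
     (\<forall>v\<in>verts G. pmf \<pi> v =
        (1 - q) / real (card (verts G)) + q * (\<Sum>u\<in>verts G. pmf \<pi> u * pmf (surf u) v))"
  unfolding is_pagerank_def by (simp add: pmf_surf)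

text \<open>The witness is the position of a \<open>surf\<close> walk from a uniform vertex after a
  geometric number of steps. That number is 0 with probability \<open>1 - q\<close>; otherwise a
  last step can be split off, and these two cases are the two terms of the PageRank
  equation.\<close>

lemma is_pagerank_exists:
  assumes "0 \<le> q" "q < 1"
  shows "\<exists>\<pi>. is_pagerank q G \<pi>"
proof -
  define U where "U = pmf_of_set (verts G)"
  define walk where "walk k = ((\<lambda>\<mu>. bind_pmf \<mu> surf) ^^ k) U" for k
  define \<pi> where "\<pi> = bind_pmf (geometric_pmf (1 - q)) walk"
  have setU: "set_pmf U = verts G"
    using verts_nonempty by (simp add: U_def)
  have set_walk: "set_pmf (walk k) \<subseteq> verts G" for k
    by (induction k) (use setU set_surf in \<open>auto simp: walk_def\<close>)
  then have set_\<pi>: "set_pmf \<pi> \<subseteq> verts G"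
    by (auto simp: \<pi>_def)
  \<comment> \<open>\<open>walk (Suc k)\<close> is \<open>walk k\<close> followed by one
    \<open>surf\<close> step, so lengthening the walk by one means applying \<open>surf\<close> to
    its end point.\<close>
  have shift: "bind_pmf (map_pmf Suc (geometric_pmf (1 - q))) walk = bind_pmf \<pi> surf"
    by (simp add: \<pi>_def bind_map_pmf bind_assoc_pmf walk_def)
  \<comment> \<open>Condition on whether the first Bernoulli trial behind the geometric variable
    succeeds.\<close>
  have eq: "\<pi> = bind_pmf (bernoulli_pmf (1 - q)) (\<lambda>b. if b then U else bind_pmf \<pi> surf)"
    unfolding shift[symmetric] unfolding \<pi>_def
    by (subst geometric_bind_pmf_unfold)
      (use assms in \<open>auto simp: bind_assoc_pmf bind_return_pmf walk_def intro!: bind_pmf_cong\<close>)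
  have pmf_\<pi>: "pmf \<pi> v = (1 - q) * pmf U v + q * (\<Sum>u\<in>verts G. pmf \<pi> u * pmf (surf u) v)" for v
  proof -
    have "pmf \<pi> v = pmf (bind_pmf (bernoulli_pmf (1 - q)) (\<lambda>b. if b then U else bind_pmf \<pi> surf)) v"
      by (rule arg_cong[OF eq])
    also have "\<dots> = (1 - q) * pmf U v + q * pmf (bind_pmf \<pi> surf) v"
      using assms by (subst pmf_bind) simp
    also have "pmf (bind_pmf \<pi> surf) v = (\<Sum>u\<in>verts G. pmf \<pi> u * pmf (surf u) v)"
      using set_\<pi> by (subst pmf_bind, subst integral_measure_pmf[of "verts G"]) auto
    finally show ?thesis .
  qed
  have "is_pagerank q G \<pi>"
    unfolding is_pagerank_surf
    by (intro conjI ballI set_\<pi>, subst pmf_\<pi>) (use verts_nonempty in \<open>simp add: U_def\<close>)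
  then show ?thesis ..
qed

text \<open>The PageRank equation is a contraction in \<open>L\<^sup>1\<close> with factor \<open>q\<close>.\<close>

lemma is_pagerank_unique:
  assumes "0 \<le> q" "q < 1" "is_pagerank q G \<pi>" "is_pagerank q G \<pi>'"
  shows "\<pi> = \<pi>'"
proof -
  define \<delta> where "\<delta> v = pmf \<pi> v - pmf \<pi>' v" for v
  have \<delta>: "\<delta> v = q * (\<Sum>u\<in>verts G. \<delta> u * pmf (surf u) v)" if "v \<in> verts G" for v
  proof -
    have "pmf \<mu> v = (1 - q) / real (card (verts G)) + q * (\<Sum>u\<in>verts G. pmf \<mu> u * pmf (surf u) v)"
      if "is_pagerank q G \<mu>" for \<mu>
      using that \<open>v \<in> verts G\<close> unfolding is_pagerank_surf by blast
    from this[OF assms(3)] this[OF assms(4)] show ?thesis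
      unfolding \<delta>_def left_diff_distrib sum_subtractf right_diff_distrib by linarith
  qed
  have "(\<Sum>v\<in>verts G. \<bar>\<delta> v\<bar>) \<le> (\<Sum>v\<in>verts G. q * (\<Sum>u\<in>verts G. \<bar>\<delta> u\<bar> * pmf (surf u) v))"
  proof (intro sum_mono)
    fix v assume "v \<in> verts G"
    have "\<bar>\<Sum>u\<in>verts G. \<delta> u * pmf (surf u) v\<bar> \<le> (\<Sum>u\<in>verts G. \<bar>\<delta> u\<bar> * pmf (surf u) v)"
      by (rule order_trans[OF sum_abs]) (simp add: abs_mult)
    then show "\<bar>\<delta> v\<bar> \<le> q * (\<Sum>u\<in>verts G. \<bar>\<delta> u\<bar> * pmf (surf u) v)"
      using \<delta>[OF \<open>v \<in> verts G\<close>] assms(1) by (simp add: abs_mult mult_left_mono)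
  qed
  also have "\<dots> = q * (\<Sum>u\<in>verts G. \<bar>\<delta> u\<bar> * (\<Sum>v\<in>verts G. pmf (surf u) v))"
    unfolding sum_distrib_left by (rule sum.swap)
  also have "\<dots> = q * (\<Sum>u\<in>verts G. \<bar>\<delta> u\<bar>)"
    by (simp add: sum_pmf_eq_1 set_surf)
  finally have "(1 - q) * (\<Sum>v\<in>verts G. \<bar>\<delta> v\<bar>) \<le> 0"
    by (simp add: algebra_simps)
  then have "(\<Sum>v\<in>verts G. \<bar>\<delta> v\<bar>) \<le> 0"
    using assms(2) by (simp add: mult_le_0_iff)
  then have "(\<Sum>v\<in>verts G. \<bar>\<delta> v\<bar>) = 0"
    by (simp add: antisym sum_nonneg)
  then have "\<delta> v = 0" if "v \<in> verts G" for v
    using that by (subst (asm) sum_nonneg_eq_0_iff) auto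
  moreover have "\<delta> v = 0" if "v \<notin> verts G" for v
    using assms(3,4) that unfolding is_pagerank_def \<delta>_def by (metis diff_self pmf_eq_0_set_pmf subsetD)
  ultimately show ?thesis
    by (intro pmf_eqI) (metis \<delta>_def eq_iff_diff_eq_0)
qed

lemma is_pagerank_pagerank:
  assumes "0 \<le> q" "q < 1"
  shows "is_pagerank q G (pagerank q G)"
  unfolding pagerank_def
  using is_pagerank_exists[OF assms] is_pagerank_unique[OF assms] by (metis theI)

text \<open>One \<open>surf\<close> step multiplies the mean of \<open>f\<close> by at most
  \<open>z\<close>. Integrating \<open>f\<close> against the PageRank equation gives
  \<open>E \<le> (1 - q) m + q z E\<close>, where \<open>E\<close> is the PageRank mean and
  \<open>m\<close> the uniform mean, and \<open>q z < 1\<close> permits solving for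
  \<open>E\<close>.\<close>

lemma expectation_pagerank_le:
  fixes f :: "'a \<Rightarrow> real"
  assumes "0 \<le> q" "q < 1" "q * z < 1"
    and f: "\<And>e. e \<in> arcs G \<Longrightarrow> f (head G e) \<le> z * f (tail G e)"
  shows "measure_pmf.expectation (pagerank q G) f
    \<le> (1 - q) / (1 - q * z) * ((\<Sum>v\<in>verts G. f v) / card (verts G))"
proof -
  define \<pi> where "\<pi> = pagerank q G"
  have pr: "is_pagerank q G \<pi>"
    using is_pagerank_pagerank assms by (simp add: \<pi>_def)
  have E: "measure_pmf.expectation \<pi> f = (\<Sum>v\<in>verts G. pmf \<pi> v * f v)"
    using pr by (subst integral_measure_pmf[of "verts G"]) (auto simp: is_pagerank_def)
  have surf: "(\<Sum>v\<in>verts G. pmf (surf u) v * f v) \<le> z * f u" if "u \<in> verts G" for u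
  proof -
    have "(\<Sum>v\<in>verts G. pmf (surf u) v * f v) = measure_pmf.expectation (surf u) f"
      using set_surf[OF that] by (subst integral_measure_pmf[of "verts G"]) auto
    also have "\<dots> = (\<Sum>e\<in>out_arcs G u. f (head G e)) / card (out_arcs G u)"
      using out_arcs_nonempty[OF that] finite_out
      by (simp add: surf_def integral_pmf_of_set)
    also have "\<dots> \<le> (\<Sum>e\<in>out_arcs G u. z * f u) / card (out_arcs G u)"
      by (intro divide_right_mono sum_mono) (use f in auto)
    also have "\<dots> = z * f u"
      using out_arcs_nonempty[OF that] finite_out by simp
    finally show ?thesis .
  qed
  have "measure_pmf.expectation \<pi> f = (\<Sum>v\<in>verts G.
      ((1 - q) / card (verts G) + q * (\<Sum>u\<in>verts G. pmf \<pi> u * pmf (surf u) v)) * f v)"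
    unfolding E using pr by (intro sum.cong) (auto simp: is_pagerank_surf)
  also have "\<dots> = (1 - q) * ((\<Sum>v\<in>verts G. f v) / card (verts G)) +
      (\<Sum>v\<in>verts G. \<Sum>u\<in>verts G. q * (pmf \<pi> u * (pmf (surf u) v * f v)))"
    by (simp add: algebra_simps sum.distrib sum_distrib_left sum_divide_distrib)
  also have "(\<Sum>v\<in>verts G. \<Sum>u\<in>verts G. q * (pmf \<pi> u * (pmf (surf u) v * f v))) =
      q * (\<Sum>u\<in>verts G. pmf \<pi> u * (\<Sum>v\<in>verts G. pmf (surf u) v * f v))"
    unfolding sum_distrib_left by (rule sum.swap)
  also have "\<dots> \<le> q * (\<Sum>u\<in>verts G. pmf \<pi> u * (z * f u))"
    using assms(1) surf by (intro mult_left_mono sum_mono) auto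
  also have "\<dots> = q * z * measure_pmf.expectation \<pi> f"
    unfolding E by (simp add: sum_distrib_left algebra_simps)
  finally have "(1 - q * z) * measure_pmf.expectation \<pi> f
      \<le> (1 - q) * ((\<Sum>v\<in>verts G. f v) / card (verts G))"
    by (simp add: algebra_simps)
  then show ?thesis
    using assms(3) unfolding \<pi>_def times_divide_eq_left
    by (subst pos_le_divide_eq) (simp_all add: mult.commute)
qed

end

section \<open>Choosing a head in a graph of constant out-degree\<close>

locale regular_digraph = fin_digraph +
  fixes d :: nat
  assumes verts_ne: "verts G \<noteq> {}"
    and d_pos: "d > 0"
    and out_degree_eq: "v \<in> verts G \<Longrightarrow> out_degree G v = d"
begin

sublocale nonsink_digraph
  by unfold_locales (use verts_ne d_pos out_degree_eq in auto)

lemma arcs_nonempty: "arcs G \<noteq> {}"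
  using verts_ne out_arcs_nonempty by fastforce

text \<open>With all out-degrees equal to \<open>d\<close>, the tail of a uniform arc is a uniform
  vertex; passing to the head costs one factor \<open>z\<close>.\<close>

lemma expectation_uniform_head_le:
  fixes f :: "'a \<Rightarrow> real"
  assumes f: "\<And>e. e \<in> arcs G \<Longrightarrow> f (head G e) \<le> z * f (tail G e)"
  shows "measure_pmf.expectation (map_pmf (head G) (pmf_of_set (arcs G))) f
    \<le> z * ((\<Sum>v\<in>verts G. f v) / card (verts G))"
proof -
  have group: "(\<Sum>e\<in>arcs G. g (tail G e)) = real d * (\<Sum>v\<in>verts G. g v)" for g :: "'a \<Rightarrow> real"
  proof -
    have "(\<Sum>e\<in>arcs G. g (tail G e)) = (\<Sum>v\<in>verts G. \<Sum>e\<in>{e\<in>arcs G. tail G e = v}. g (tail G e))"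
      by (rule sum.group[symmetric]) auto
    also have "\<dots> = (\<Sum>v\<in>verts G. real d * g v)"
    proof (intro sum.cong refl)
      fix v assume "v \<in> verts G"
      then show "(\<Sum>e\<in>{e\<in>arcs G. tail G e = v}. g (tail G e)) = real d * g v"
        using out_degree_eq[of v] by (simp add: out_degree_def out_arcs_def)
    qed
    finally show ?thesis by (simp add: sum_distrib_left)
  qed
  have card: "real (card (arcs G)) = real d * real (card (verts G))"
    using group[of "\<lambda>_. 1"] by simp
  have "measure_pmf.expectation (map_pmf (head G) (pmf_of_set (arcs G))) f =
      (\<Sum>e\<in>arcs G. f (head G e)) / card (arcs G)"
    using arcs_nonempty by (simp add: integral_pmf_of_set)
  also have "\<dots> \<le> (\<Sum>e\<in>arcs G. z * f (tail G e)) / card (arcs G)"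
    by (intro divide_right_mono sum_mono f) auto
  also have "\<dots> = z * ((\<Sum>v\<in>verts G. f v) / card (verts G))"
    using group[of f] d_pos by (simp add: card sum_distrib_left[symmetric])
  finally show ?thesis .
qed

context
  fixes pa pb pc q :: real
  assumes p: "pa \<ge> 0" "pb \<ge> 0" "pc \<ge> 0" "pa + pb + pc = 1" and q: "0 \<le> q" "q < 1"
begin

lemma set_hybrid_head: "set_pmf (hybrid_head pa pb pc q G) \<subseteq> verts G"
proof -
  define L where "L = [(pmf_of_set (verts G), pa),
      (map_pmf (head G) (pmf_of_set (arcs G)), pb), (pagerank q G, pc)]"
  have "pmf_of_list_wf L"
    unfolding L_def using p by (intro pmf_of_list_wfI) auto
  then have "set_pmf (pmf_of_list L) \<subseteq> set (map fst L)"
    by (rule set_pmf_of_list)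
  moreover have "set_pmf M \<subseteq> verts G" if "M \<in> set (map fst L)" for M
    using that is_pagerank_pagerank[OF q]
    by (auto simp: L_def is_pagerank_def set_pmf_of_set verts_ne arcs_nonempty)
  ultimately show ?thesis
    unfolding hybrid_head_def L_def[symmetric] set_pmf_join_pmf by blast
qed

text \<open>The law is a mixture of three, and compared with the uniform mean they cost the factors
  1, \<open>z\<close> and \<open>(1 - q) / (1 - q z)\<close>.\<close>

lemma expectation_hybrid_head_le:
  fixes f :: "'a \<Rightarrow> real"
  assumes qz: "q * z < 1"
    and f: "\<And>e. e \<in> arcs G \<Longrightarrow> f (head G e) \<le> z * f (tail G e)"
  shows "measure_pmf.expectation (hybrid_head pa pb pc q G) f
    \<le> (pa + pb * z + pc * ((1 - q) / (1 - q * z))) * ((\<Sum>v\<in>verts G. f v) / card (verts G))"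
proof -
  define L where "L = [(pmf_of_set (verts G), pa),
      (map_pmf (head G) (pmf_of_set (arcs G)), pb), (pagerank q G, pc)]"
  define m where "m = (\<Sum>v\<in>verts G. f v) / card (verts G)"
  have wf: "pmf_of_list_wf L"
    unfolding L_def using p by (intro pmf_of_list_wfI) auto
  have set_pr: "set_pmf (pagerank q G) \<subseteq> verts G"
    using is_pagerank_pagerank[OF q] by (simp add: is_pagerank_def)
  have pmf: "pmf (hybrid_head pa pb pc q G) v = pa * pmf (pmf_of_set (verts G)) v +
      pb * pmf (map_pmf (head G) (pmf_of_set (arcs G))) v + pc * pmf (pagerank q G) v" for v
    unfolding hybrid_head_def pmf_join L_def[symmetric] expectation_pmf_of_list[OF wf]
    by (simp add: L_def)
  have E: "measure_pmf.expectation M f = (\<Sum>v\<in>verts G. pmf M v * f v)"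
    if "set_pmf M \<subseteq> verts G" for M
    using that by (subst integral_measure_pmf[of "verts G"]) auto
  have "measure_pmf.expectation (hybrid_head pa pb pc q G) f =
      pa * measure_pmf.expectation (pmf_of_set (verts G)) f +
      pb * measure_pmf.expectation (map_pmf (head G) (pmf_of_set (arcs G))) f +
      pc * measure_pmf.expectation (pagerank q G) f"
    using set_hybrid_head set_pr
    by (subst (1 2 3 4) E)
      (auto simp: pmf algebra_simps sum.distrib sum_distrib_left set_pmf_of_set verts_ne arcs_nonempty)
  also have "\<dots> \<le> pa * m + pb * (z * m) + pc * ((1 - q) / (1 - q * z) * m)"
    unfolding m_def
    using expectation_uniform_head_le[OF f] expectation_pagerank_le[OF q qz f] p verts_ne
    by (intro add_mono mult_left_mono) (auto simp: integral_pmf_of_set)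
  finally show ?thesis
    by (simp add: m_def algebra_simps)
qed

end

end

section \<open>Growth of the potential\<close>

definition potential :: "real \<Rightarrow> 'v \<Rightarrow> ('v, 'e) pre_digraph \<Rightarrow> real" where
  "potential z r G = (\<Sum>v\<in>verts G. z ^ depth G r v)"

text \<open>The invariant of the process. The vertex set shows that the next vertex is fresh and
  bounds the size from below; the clause on tails ensures that arcs added later leave the newborn
  vertex, as tails are fixed once and for all in \<open>initial_graph\<close>.\<close>

definition hybrid_state ::
    "'v + nat \<Rightarrow> 'v set \<Rightarrow> nat \<Rightarrow> nat \<Rightarrow> ('v + nat, 'e + nat \<times> nat) pre_digraph \<Rightarrow> bool" where
  "hybrid_state r V d t G \<longleftrightarrow>
     regular_digraph G d \<and> verts G = Inl ` V \<union> Inr ` {1..t} \<and>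
     (\<forall>s i. tail G (Inr (s, i)) = Inr s) \<and> (\<forall>v\<in>verts G. (r, v) \<in> (adjacency G)\<^sup>*)"

lemma hybrid_state_initial:
  assumes "fin_digraph G" and "Digraph_Component.connected G" and "d \<ge> 1"
    and deg: "\<And>v. v \<in> verts G \<Longrightarrow> out_degree G v = d" and r: "r \<in> verts G"
  shows "hybrid_state (Inl r) (verts G) d 0 (initial_graph G)"
proof -
  interpret fin_digraph G by fact
  have arcs: "out_arcs (initial_graph G) (Inl v) = Inl ` out_arcs G v" for v
    by (auto simp: initial_graph_def out_arcs_def)
  have reg: "regular_digraph (initial_graph G) d"
    using assms(3) r by unfold_locales
      (auto simp: initial_graph_def out_degree_def arcs[unfolded initial_graph_def]
        card_image deg[unfolded out_degree_def])
  have adj: "(Inl u, Inl v) \<in> adjacency (initial_graph G)" if "(u, v) \<in> adjacency G" for u v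
    using that by (force simp: adjacency_alt initial_graph_def)
  have "(Inl r, Inl v) \<in> (adjacency (initial_graph G))\<^sup>*" if "v \<in> verts G" for v
  proof -
    \<comment> \<open>Weak connectedness is defined as strong connectedness of the symmetrised
      graph.\<close>
    have "r \<rightarrow>\<^sup>*\<^bsub>with_proj (mk_symmetric G)\<^esub> v"
      using assms(2) that r by (auto simp: Digraph_Component.connected_def strongly_connected_def)
    then have "(r, v) \<in> (adjacency G)\<^sup>*"
      unfolding reachable_def adjacency_def by (auto dest: rtrancl_on_rtranclI)
    then show ?thesis
      by (induction rule: rtrancl_induct) (auto intro: adj rtrancl_into_rtrancl)
  qed
  with reg show ?thesis
    by (auto simp: hybrid_state_def initial_graph_def)
qed

text \<open>The bound depends on \<open>K\<close> and \<open>z\<close> alone, hence is uniform over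
  initial graphs that vary with \<open>n\<close>.\<close>

lemma potential_initial_le:
  assumes state: "hybrid_state r V d 0 G" and "card V \<le> K" and "1 \<le> z"
  shows "potential z r G \<le> real K * z ^ (K ^ 2)"
proof -
  interpret regular_digraph G d
    using state by (simp add: hybrid_state_def)
  have card: "card (verts G) = card V"
    using state by (simp add: hybrid_state_def card_image)
  have "potential z r G \<le> (\<Sum>v\<in>verts G. z ^ (K ^ 2))"
    unfolding potential_def
  proof (intro sum_mono power_increasing \<open>1 \<le> z\<close>)
    fix v assume "v \<in> verts G"
    then have "depth G r v \<le> card (verts G) ^ 2"
      using state by (intro depth_le_card) (auto simp: hybrid_state_def)
    also have "\<dots> \<le> K ^ 2"
      using assms(2) by (simp add: card power_mono)
    finally show "depth G r v \<le> K ^ 2" .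
  qed
  also have "\<dots> \<le> real K * z ^ (K ^ 2)"
    using assms(2,3) by (simp add: card mult_right_mono)
  finally show ?thesis .
qed

text \<open>The root and the \<open>t\<close> born vertices are distinct. This turns a mean over all
  vertices into a factor of at most \<open>1 / (t + 1)\<close>.\<close>

lemma card_verts_hybrid_state:
  assumes state: "hybrid_state r V d t G" and "r \<in> Inl ` V"
  shows "card (verts G) \<ge> Suc t"
proof -
  interpret regular_digraph G d
    using state by (simp add: hybrid_state_def)
  have verts: "verts G = Inl ` V \<union> Inr ` {1..t}"
    using state by (simp add: hybrid_state_def)
  then have "card (verts G) \<ge> card (insert r (Inr ` {1..t}))"
    using assms(2) by (intro card_mono finite_verts) auto
  moreover have "card (insert r (Inr ` {1..t})) = Suc t"
    using assms(2) by (subst card_insert_disjoint) (auto simp: card_image)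
  ultimately show ?thesis by simp
qed

text \<open>Old depths do not increase, and the first outgoing arc puts the newborn vertex at most
  one level below its head \<open>hs ! 0\<close>.\<close>

lemma add_born_vertex_hybrid_state:
  assumes state: "hybrid_state r V d t G" and hs: "set hs \<subseteq> verts G" "length hs = d"
  defines "H \<equiv> add_born_vertex (Suc t) hs G"
  shows "hybrid_state r V d (Suc t) H"
    and "1 \<le> z \<Longrightarrow> potential z r H \<le> potential z r G + z * z ^ depth G r (hs ! 0)"
proof -
  interpret regular_digraph G d
    using state by (simp add: hybrid_state_def)
  define b :: "'a + nat" where "b = Inr (Suc t)"
  define N :: "('b + nat \<times> nat) set" where "N = (\<lambda>i. Inr (Suc t, i)) ` {..<d}"
  have verts: "verts G = Inl ` V \<union> Inr ` {1..t}"
    and tail_Inr: "\<And>s i. tail G (Inr (s, i)) = Inr s"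
    and reach: "\<And>v. v \<in> verts G \<Longrightarrow> (r, v) \<in> (adjacency G)\<^sup>*"
    using state by (auto simp: hybrid_state_def)
  have b_new: "b \<notin> verts G"
    by (auto simp: verts b_def)
  \<comment> \<open>Arcs of \<open>G\<close> have their tails in \<open>verts G\<close>, while the
    arcs in \<open>N\<close> have the fresh vertex \<open>b\<close> as tail.\<close>
  have N_new: "N \<inter> arcs G = {}"
    using b_new tail_Inr by (auto simp: N_def b_def dest!: tail_in_verts)
  have vH: "verts H = insert b (verts G)"
    and aH: "arcs H = arcs G \<union> N"
    and tH: "tail H = tail G"
    by (auto simp: H_def add_born_vertex_def b_def N_def hs)
  have hN: "head H (Inr (Suc t, i)) = hs ! i" if "i < d" for i
    using that hs by (simp add: H_def add_born_vertex_def)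
  have hG: "head H e = head G e" if "e \<in> arcs G" for e
    using that N_new hs by (auto simp: H_def add_born_vertex_def N_def)
  have hs_in: "hs ! i \<in> verts G" if "i < d" for i
    using that hs by (auto simp: subset_iff)
  have tN: "tail G e = b" if "e \<in> N" for e
    using that tail_Inr by (auto simp: N_def b_def)
  have out_b: "out_arcs H b = N"
    using tN b_new by (auto simp: out_arcs_def aH tH)
  have out_G: "out_arcs H v = out_arcs G v" if "v \<in> verts G" for v
    using tN b_new that by (auto simp: out_arcs_def aH tH)
  have card_N: "card N = d"
    unfolding N_def by (subst card_image) (auto simp: inj_on_def)
  have reg: "regular_digraph H d"
  proof unfold_locales
    fix e assume "e \<in> arcs H"
    then show "tail H e \<in> verts H"
      by (auto simp: aH tH vH tN)
    show "head H e \<in> verts H"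
    proof (cases "e \<in> N")
      case True
      then show ?thesis using hN hs_in by (auto simp: N_def vH)
    next
      case False
      then show ?thesis using \<open>e \<in> arcs H\<close> by (auto simp: aH vH hG)
    qed
  next
    fix v assume "v \<in> verts H"
    then show "out_degree H v = d"
      using out_degree_eq by (auto simp: vH out_degree_def out_b out_G card_N)
  qed (use d_pos in \<open>auto simp: vH aH N_def\<close>)
  have adj: "adjacency G \<subseteq> adjacency H"
    by (auto simp: adjacency_alt aH tH hG)
  have reach': "(r, v) \<in> (adjacency H)\<^sup>*" if "v \<in> verts G" for v
    using reach[OF that] rtrancl_mono[OF adj] by auto
  have edge: "(hs ! 0, b) \<in> adjacency H"
  proof -
    have "(head H (Inr (Suc t, 0)), tail H (Inr (Suc t, 0))) \<in> adjacency H"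
      using d_pos unfolding adjacency_alt aH N_def by blast
    then show ?thesis
      by (simp add: hN[OF d_pos] tH tail_Inr b_def)
  qed
  have reach_b: "(r, b) \<in> (adjacency H)\<^sup>*"
    using reach'[OF hs_in[OF d_pos]] edge by (rule rtrancl_into_rtrancl)
  show "hybrid_state r V d (Suc t) H"
    unfolding hybrid_state_def using reg reach' reach_b tail_Inr
    by (auto simp: vH tH verts b_def atLeastAtMostSuc_conv)
  assume "1 \<le> z"
  have "depth H r b \<le> Suc (depth H r (hs ! 0))"
    by (rule depth_adjacent[OF reach'[OF hs_in[OF d_pos]] edge])
  also have "\<dots> \<le> Suc (depth G r (hs ! 0))"
    using depth_mono[OF adj reach[OF hs_in[OF d_pos]]] by simp
  finally have "z ^ depth H r b \<le> z * z ^ depth G r (hs ! 0)"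
    using power_increasing[OF _ \<open>1 \<le> z\<close>] by fastforce
  moreover have "(\<Sum>v\<in>verts G. z ^ depth H r v) \<le> (\<Sum>v\<in>verts G. z ^ depth G r v)"
    by (intro sum_mono power_increasing depth_mono adj reach \<open>1 \<le> z\<close>)
  ultimately show "potential z r H \<le> potential z r G + z * z ^ depth G r (hs ! 0)"
    using b_new by (simp add: potential_def vH)
qed

text \<open>Reduces a mean over \<open>d\<close> independent heads to a mean over a single
  one.\<close>

lemma map_nth_0_replicate_pmf:
  "d \<ge> 1 \<Longrightarrow> map_pmf (\<lambda>xs. xs ! 0) (replicate_pmf d p) = p"
  by (cases d) (simp_all add: map_bind_pmf bind_return_pmf')

section \<open>Choice of the base and the mean of the potential\<close>

context
  fixes pa pb pc q :: real and d :: nat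
  assumes p: "pa \<ge> 0" "pb \<ge> 0" "pc \<ge> 0" "pa + pb + pc = 1" and q: "0 \<le> q" "q < 1"
    and d: "d \<ge> 1"
begin

text \<open>The base \<open>z\<close> of the potential. It satisfies
  \<open>1 - q z = (1 - q) (2 - q) / 2\<close>, so the PageRank factor becomes
  \<open>2 / (2 - q)\<close>, which stays below 2 however close \<open>q\<close> is to 1.\<close>

definition growth :: real where
  "growth = 1 + (1 - q) / 2"

text \<open>The fourth bound is a convex combination of three quantities, each at most 3; an integer
  here lets the product of the step factors telescope to a polynomial. The last bound converts depth
  into a power of \<open>n\<close>.\<close>

lemma growth_bounds:
  shows "1 \<le> growth" "growth \<le> 3 / 2" "q * growth < 1"
    and "growth * (pa + pb * growth + pc * ((1 - q) / (1 - q * growth))) \<le> 3"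
    and "exp (7 / 20 * (1 - q)) \<le> growth"
proof -
  show 1: "1 \<le> growth" and 2: "growth \<le> 3 / 2"
    using q by (auto simp: growth_def)
  have eq: "1 - q * growth = (1 - q) * (2 - q) / 2"
    by (simp add: growth_def field_simps)
  then show "q * growth < 1"
    using q by (smt (verit) divide_pos_pos mult_pos_pos)
  have pr: "(1 - q) / (1 - q * growth) = 2 / (2 - q)"
  proof -
    have "(1 - q) / (1 - q * growth) = ((1 - q) * 2) / ((1 - q) * (2 - q))"
      unfolding eq by simp
    then show ?thesis
      using q by (subst (asm) mult_divide_mult_cancel_left) auto
  qed
  have g2: "growth * growth \<le> 3"
    using mult_mono[OF 2 2] 1 by simp
  have g3: "growth * (2 / (2 - q)) \<le> 3"
    using q by (simp add: growth_def field_simps)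
  have "growth * (pa + pb * growth + pc * ((1 - q) / (1 - q * growth))) =
      pa * growth + pb * (growth * growth) + pc * (growth * (2 / (2 - q)))"
    by (simp add: pr algebra_simps)
  also have "\<dots> \<le> pa * 3 + pb * 3 + pc * 3"
    using p g2 g3 2 by (intro add_mono mult_left_mono) auto
  also have "\<dots> = 3"
    using p by linarith
  finally show "growth * (pa + pb * growth + pc * ((1 - q) / (1 - q * growth))) \<le> 3" .
  have "exp (7 / 20 * (1 - q)) \<le> 1 + 7 / 20 * (1 - q) + (7 / 20 * (1 - q))\<^sup>2"
    using q by (intro exp_bound) auto
  \<comment> \<open>Here \<open>(1 - q)\<^sup>2 \<le> 1 - q\<close>; the coefficients of
    \<open>1 - q\<close> then add up to 189/400, below the 1/2 in \<open>growth\<close>.\<close>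
  also have "\<dots> \<le> 1 + 7 / 20 * (1 - q) + (7 / 20)\<^sup>2 * (1 - q)"
    unfolding power_mult_distrib using q
    by (intro add_left_mono mult_left_mono) (auto simp: power2_eq_square intro: mult_left_le)
  also have "\<dots> \<le> growth"
    using q by (simp add: growth_def power2_eq_square field_simps)
  finally show "exp (7 / 20 * (1 - q)) \<le> growth" .
qed

lemma set_replicate_hybrid_head:
  assumes state: "hybrid_state r V d t G"
    and hs: "hs \<in> set_pmf (replicate_pmf d (hybrid_head pa pb pc q G))"
  shows "set hs \<subseteq> verts G" "length hs = d"
proof -
  interpret regular_digraph G d
    using state by (simp add: hybrid_state_def)
  show "set hs \<subseteq> verts G" "length hs = d"
    using hs set_hybrid_head[OF p q] by (auto simp: set_replicate_pmf)
qed

lemma hybrid_state_hybrid_graph: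
  assumes init: "hybrid_state r V d 0 (initial_graph G0)"
    and G: "G \<in> set_pmf (hybrid_graph pa pb pc q d G0 t)"
  shows "hybrid_state r V d t G"
  using G
proof (induction t arbitrary: G)
  case 0
  then show ?case using init by simp
next
  case (Suc t)
  then obtain G' hs where "hybrid_state r V d t G'"
    "hs \<in> set_pmf (replicate_pmf d (hybrid_head pa pb pc q G'))"
    "G = add_born_vertex (Suc t) hs G'"
    by auto
  then show ?case
    using add_born_vertex_hybrid_state(1) set_replicate_hybrid_head by metis
qed

text \<open>Depth rises by at most 1 along an arc, so \<open>growth ^ depth\<close> meets the
  hypothesis of the head estimates. The newborn vertex then adds in expectation at most 3 times the
  mean of the potential per vertex. Nonnegative integrals avoid integrability questions for the law
  of the process.\<close>

lemma nn_integral_potential_step: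
  assumes state: "hybrid_state r V d t G" and r: "r \<in> Inl ` V"
  shows "(\<integral>\<^sup>+ hs. potential growth r (add_born_vertex (Suc t) hs G)
      \<partial>replicate_pmf d (hybrid_head pa pb pc q G))
    \<le> ennreal ((1 + 3 / real (Suc t)) * potential growth r G)"
proof -
  interpret regular_digraph G d
    using state by (simp add: hybrid_state_def)
  define f where "f v = growth ^ depth G r v" for v
  define M where "M = hybrid_head pa pb pc q G"
  define \<phi> where "\<phi> = pa + pb * growth + pc * ((1 - q) / (1 - q * growth))"
  have f_nonneg: "f v \<ge> 0" for v
    using growth_bounds(1) by (simp add: f_def)
  have pot: "potential growth r G = (\<Sum>v\<in>verts G. f v)"
    by (simp add: potential_def f_def)
  have pot_nonneg: "potential growth r G \<ge> 0"
    unfolding pot by (intro sum_nonneg f_nonneg)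
  have f_head: "f (head G e) \<le> growth * f (tail G e)" if "e \<in> arcs G" for e
  proof -
    have "(r, tail G e) \<in> (adjacency G)\<^sup>*"
      using state tail_in_verts[OF that] unfolding hybrid_state_def by blast
    moreover have "(tail G e, head G e) \<in> adjacency G"
      using that by (auto simp: adjacency_alt)
    ultimately have "depth G r (head G e) \<le> Suc (depth G r (tail G e))"
      by (rule depth_adjacent)
    then show ?thesis
      using power_increasing[OF _ growth_bounds(1)] by (fastforce simp: f_def)
  qed
  have finM: "finite (set_pmf M)"
    using set_hybrid_head[OF p q] by (auto simp: M_def intro: finite_subset)
  have "(\<integral>\<^sup>+ hs. potential growth r (add_born_vertex (Suc t) hs G) \<partial>replicate_pmf d M)
      \<le> (\<integral>\<^sup>+ hs. ennreal (potential growth r G + growth * f (hs ! 0)) \<partial>replicate_pmf d M)"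
    using add_born_vertex_hybrid_state(2)[OF state _ _ growth_bounds(1)]
      set_replicate_hybrid_head[OF state]
    by (intro nn_integral_mono_AE AE_pmfI) (auto simp: M_def f_def intro!: ennreal_leI)
  also have "\<dots> = (\<integral>\<^sup>+ v. ennreal (potential growth r G + growth * f v)
      \<partial>map_pmf (\<lambda>hs. hs ! 0) (replicate_pmf d M))"
    by simp
  also have "\<dots> = (\<integral>\<^sup>+ v. ennreal (potential growth r G + growth * f v) \<partial>M)"
    by (simp add: map_nth_0_replicate_pmf[OF d] del: nn_integral_map_pmf)
  also have "\<dots> = ennreal (measure_pmf.expectation M (\<lambda>v. potential growth r G + growth * f v))"
    using growth_bounds(1) f_nonneg pot_nonneg
    by (intro nn_integral_eq_integral integrable_measure_pmf_finite[OF finM]) auto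
  also have "measure_pmf.expectation M (\<lambda>v. potential growth r G + growth * f v) =
      potential growth r G + growth * measure_pmf.expectation M f"
    by (simp add: integrable_measure_pmf_finite[OF finM])
  also have "growth * measure_pmf.expectation M f
      \<le> growth * (\<phi> * (potential growth r G / card (verts G)))"
    unfolding M_def \<phi>_def pot
    using growth_bounds(1) f_head
    by (intro mult_left_mono expectation_hybrid_head_le[OF p q growth_bounds(3)]) auto
  also have "\<dots> = (growth * \<phi>) * (potential growth r G / card (verts G))"
    by simp
  also have "\<dots> \<le> 3 * (potential growth r G / Suc t)"
  proof (rule mult_mono)
    show "growth * \<phi> \<le> 3"
      using growth_bounds(4) by (simp add: \<phi>_def)
    show "potential growth r G / card (verts G) \<le> potential growth r G / Suc t"
      using card_verts_hybrid_state[OF state r] pot_nonneg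
      by (intro divide_left_mono) auto
  qed (use pot_nonneg in auto)
  finally show ?thesis
    by (simp add: M_def algebra_simps ennreal_leI)
qed

text \<open>The product of \<open>1 + 3 / s\<close> over \<open>s = 1, ..., t\<close> telescopes to
  \<open>(t + 1) (t + 2) (t + 3) / 6\<close>.\<close>

lemma nn_integral_potential_le:
  assumes init: "hybrid_state r V d 0 (initial_graph G0)" and r: "r \<in> Inl ` V"
  shows "(\<integral>\<^sup>+ G. potential growth r G \<partial>hybrid_graph pa pb pc q d G0 t)
    \<le> ennreal ((real t + 1) * (real t + 2) * (real t + 3) / 6 *
        potential growth r (initial_graph G0))"
proof (induction t)
  case 0
  then show ?case by simp
next
  case (Suc t)
  define S where "S = potential growth r (initial_graph G0)"
  have "(\<integral>\<^sup>+ G. potential growth r G \<partial>hybrid_graph pa pb pc q d G0 (Suc t)) =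
      (\<integral>\<^sup>+ G. \<integral>\<^sup>+ hs. potential growth r (add_born_vertex (Suc t) hs G)
        \<partial>replicate_pmf d (hybrid_head pa pb pc q G) \<partial>hybrid_graph pa pb pc q d G0 t)"
    by simp
  also have "\<dots> \<le> (\<integral>\<^sup>+ G. ennreal (1 + 3 / real (Suc t)) * ennreal (potential growth r G)
      \<partial>hybrid_graph pa pb pc q d G0 t)"
    using nn_integral_potential_step[OF hybrid_state_hybrid_graph[OF init] r]
    by (intro nn_integral_mono_AE AE_pmfI) (simp add: ennreal_mult')
  also have "\<dots> = ennreal (1 + 3 / real (Suc t)) *
      (\<integral>\<^sup>+ G. potential growth r G \<partial>hybrid_graph pa pb pc q d G0 t)"
    by (rule nn_integral_cmult) simp
  also have "\<dots> \<le> ennreal (1 + 3 / real (Suc t)) *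
      ennreal ((real t + 1) * (real t + 2) * (real t + 3) / 6 * S)"
    using Suc.IH by (intro mult_left_mono) (auto simp: S_def)
  also have "\<dots> = ennreal ((1 + 3 / real (Suc t)) *
      ((real t + 1) * (real t + 2) * (real t + 3) / 6 * S))"
    by (rule ennreal_mult'[symmetric]) simp
  also have "(1 + 3 / real (Suc t)) * ((real t + 1) * (real t + 2) * (real t + 3) / 6 * S) =
      (real (Suc t) + 1) * (real (Suc t) + 2) * (real (Suc t) + 3) / 6 * S"
    by (simp add: divide_simps) (simp add: algebra_simps)
  finally show ?case
    by (simp add: S_def)
qed

section \<open>Markov's inequality and the limit\<close>

text \<open>A large diameter forces a vertex deeper than \<open>h\<close>, whose term alone lifts
  the potential to \<open>n powr (63 / 20)\<close>. The exponent is 9 times 7/20: the depth constant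
  times the rate in \<open>growth_bounds\<close>.\<close>

lemma prob_large_diameter_le:
  fixes G0 :: "('v, 'e) pre_digraph"
  assumes G0: "fin_digraph G0" "Digraph_Component.connected G0"
      "\<And>v. v \<in> verts G0 \<Longrightarrow> out_degree G0 v = d" "card (verts G0) \<le> K"
    and "n \<ge> 1"
  shows "measure_pmf.prob (hybrid_graph pa pb pc q d G0 n)
      {G. \<not> undirected_diameter G \<le> ereal (18 * ln (real n) / (1 - q))}
    \<le> (real n + 1) * (real n + 2) * (real n + 3) / 6 * (real K * (3 / 2) ^ (K ^ 2)) /
      real n powr (63 / 20)"
proof -
  obtain r0 where r0: "r0 \<in> verts G0"
    using G0(2) by (auto simp: Digraph_Component.connected_def strongly_connected_def)
  define r :: "'v + nat" where "r = Inl r0"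
  define h where "h = 9 * ln (real n) / (1 - q)"
  define B where "B = {G :: ('v + nat, 'e + nat \<times> nat) pre_digraph.
    \<not> undirected_diameter G \<le> ereal (18 * ln (real n) / (1 - q))}"
  define M where "M = hybrid_graph pa pb pc q d G0 n"
  define c where "c = real n powr (63 / 20)"
  define P where "P = (real n + 1) * (real n + 2) * (real n + 3) / 6"
  have init: "hybrid_state r (verts G0) d 0 (initial_graph G0)"
    unfolding r_def using G0 d r0 by (intro hybrid_state_initial) auto
  have r: "r \<in> Inl ` verts G0"
    using r0 by (simp add: r_def)
  have c_pos: "c > 0"
    using \<open>n \<ge> 1\<close> by (simp add: c_def)
  have large: "c \<le> potential growth r G" if "G \<in> set_pmf M" "G \<in> B" for G
  proof -
    have state: "hybrid_state r (verts G0) d n G"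
      using hybrid_state_hybrid_graph[OF init] that(1) by (simp add: M_def)
    then interpret regular_digraph G d
      by (simp add: hybrid_state_def)
    have "\<not> undirected_diameter G \<le> ereal (2 * h)"
      using that(2) by (simp add: B_def h_def)
    then obtain v where v: "v \<in> verts G" "h < real (depth G r v)"
      using undirected_diameter_le[OF wf_digraph, of r h] state
      unfolding hybrid_state_def by (meson not_le)
    have "c = exp (7 / 20 * (1 - q) * h)"
    proof -
      have "(1 - q) * h = 9 * ln (real n)"
        using q by (simp add: h_def)
      then show ?thesis
        using \<open>n \<ge> 1\<close> unfolding mult.assoc by (simp add: c_def powr_def)
    qed
    also have "\<dots> \<le> exp (7 / 20 * (1 - q) * real (depth G r v))"
      using v(2) q by simp
    also have "\<dots> = exp (7 / 20 * (1 - q)) ^ depth G r v"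
      by (simp add: exp_of_nat_mult[symmetric] mult.commute)
    also have "\<dots> \<le> growth ^ depth G r v"
      by (intro power_mono growth_bounds(5)) simp
    also have "\<dots> \<le> potential growth r G"
      unfolding potential_def using growth_bounds(1) v(1) by (intro member_le_sum) auto
    finally show ?thesis .
  qed
  \<comment> \<open>Markov's inequality in the form \<open>c * indicator B \<le> potential\<close>,
    which holds on the support of \<open>M\<close>.\<close>
  have "ennreal (c * measure_pmf.prob M B) = (\<integral>\<^sup>+ G. ennreal c * indicator B G \<partial>M)"
    using c_pos by (simp add: nn_integral_cmult_indicator measure_pmf.emeasure_eq_measure ennreal_mult')
  also have "\<dots> \<le> (\<integral>\<^sup>+ G. potential growth r G \<partial>M)"
    using large by (intro nn_integral_mono_AE AE_pmfI) (auto simp: indicator_def intro: ennreal_leI)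
  also have "\<dots> \<le> ennreal (P * potential growth r (initial_graph G0))"
    unfolding M_def P_def by (rule nn_integral_potential_le[OF init r])
  also have "\<dots> \<le> ennreal (P * (real K * (3 / 2) ^ (K ^ 2)))"
  proof (intro ennreal_leI mult_left_mono)
    have "potential growth r (initial_graph G0) \<le> real K * growth ^ (K ^ 2)"
      using potential_initial_le[OF init G0(4) growth_bounds(1)] .
    also have "\<dots> \<le> real K * (3 / 2) ^ (K ^ 2)"
      using growth_bounds(1,2) by (intro mult_left_mono power_mono) auto
    finally show "potential growth r (initial_graph G0) \<le> real K * (3 / 2) ^ (K ^ 2)" .
  qed (simp add: P_def)
  finally have "c * measure_pmf.prob M B \<le> P * (real K * (3 / 2) ^ (K ^ 2))"
    by (subst (asm) ennreal_le_iff) (auto simp: P_def)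
  then show ?thesis
    using c_pos by (simp add: M_def B_def c_def P_def pos_le_divide_eq mult.commute)
qed

end

theorem theorem2p5:
  fixes pa pb pc q :: real and d K :: nat
    and G0 :: "nat \<Rightarrow> ('v, 'e) pre_digraph"
  assumes "pa \<ge> 0" and "pb \<ge> 0" and "pc \<ge> 0" and "pa + pb + pc = 1"
    and "d \<ge> 1"
    and "0 \<le> q" and "q \<le> 1" and "q < 1"
    and "\<And>n. fin_digraph (G0 n)"
    and "\<And>n. Digraph_Component.connected (G0 n)"
    and "\<And>n v. v \<in> verts (G0 n) \<Longrightarrow> out_degree (G0 n) v = d"
    and "\<And>n. card (verts (G0 n)) \<le> K"
  shows "(\<lambda>n. measure_pmf.prob (hybrid_graph pa pb pc q d (G0 n) n)
            {G. undirected_diameter G \<le> ereal (18 * ln (real n) / (1 - q))})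
          \<longlonglongrightarrow> 1"
proof -
  define A where "A n = {G :: ('v + nat, 'e + nat \<times> nat) pre_digraph.
    undirected_diameter G \<le> ereal (18 * ln (real n) / (1 - q))}" for n :: nat
  define M where "M n = hybrid_graph pa pb pc q d (G0 n) n" for n
  define C where "C = real K * (3 / 2) ^ (K ^ 2)"
  define g where "g n = (real n + 1) * (real n + 2) * (real n + 3) / 6 * C / real n powr (63 / 20)"
    for n :: nat
  have prob: "measure_pmf.prob (M n) (A n) = 1 - measure_pmf.prob (M n) (- A n)" for n
    using measure_pmf.prob_compl[of "- A n" "M n"] by (simp add: Compl_eq_Diff_UNIV[symmetric])
  \<comment> \<open>The numerator is cubic in \<open>n\<close> and \<open>C\<close> is constant, so
    \<open>g\<close> decays like \<open>n powr (- 3 / 20)\<close>, or vanishes if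
    \<open>C = 0\<close>.\<close>
  have g: "g \<longlonglongrightarrow> 0"
    unfolding g_def by real_asymp
  have le: "\<forall>\<^sub>F n in sequentially. measure_pmf.prob (M n) (- A n) \<le> g n"
    using eventually_ge_at_top[of 1]
  proof eventually_elim
    case (elim n)
    have "- A n = {G. \<not> undirected_diameter G \<le> ereal (18 * ln (real n) / (1 - q))}"
      by (auto simp: A_def)
    then show ?case
      using prob_large_diameter_le[OF assms(1-4,6,8,5) assms(9-12) elim]
      by (simp add: M_def g_def C_def)
  qed
  have "(\<lambda>n. measure_pmf.prob (M n) (- A n)) \<longlonglongrightarrow> 0"
    by (rule tendsto_sandwich[OF _ le tendsto_const g]) simp
  then have "(\<lambda>n. measure_pmf.prob (M n) (A n)) \<longlonglongrightarrow> 1 - 0"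
    unfolding prob by (intro tendsto_diff tendsto_const)
  then show ?thesis
    by (simp add: M_def A_def)
qed

end
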